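(* Let $m\geq 2$ be an integer. There is no complex-linear isometry (norm-preserving linear map, not assumed surjective) from $\ell_1^m$ to $S_\infty$.
   Context: All Banach spaces are complex. $\ell_1^m$ is $\mathbb{C}^m$ with the norm $\|(z_1,\dots,z_m)\|_1=\sum_{i=1}^m|z_i|$. $\ell_2$ is the complex Hilbert space of square-summable sequences, $B(\ell_2)$ is the space of bounded linear operators on $\ell_2$ with the operator norm, and $S_\infty\subseteq B(\ell_2)$ is the space of all compact operators on $\ell_2$ with the operator norm. *)

theory Defs
  imports "HOL-Analysis.Analysis"
begin

typedef ell2 = "{x :: nat \<Rightarrow> complex. summable (\<lambda>n. (cmod (x n))\<^sup>2)}"
  morphisms ell2_nth Abs_ell2
  by (rule exI[of _ "\<lambda>_. 0"]) simp

setup_lifting type_definition_ell2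

lemma summable_ell2: "summable (\<lambda>n. (cmod (ell2_nth x n))\<^sup>2)"
  using ell2_nth[of x] by simp

lemma summable_sq_add:
  fixes x y :: "nat \<Rightarrow> complex"
  assumes "summable (\<lambda>n. (cmod (x n))\<^sup>2)" "summable (\<lambda>n. (cmod (y n))\<^sup>2)"
  shows "summable (\<lambda>n. (cmod (x n + y n))\<^sup>2)"
proof (rule summable_comparison_test'[where N = 0])
  show "summable (\<lambda>n. 2 * (cmod (x n))\<^sup>2 + 2 * (cmod (y n))\<^sup>2)"
    by (intro summable_add summable_mult assms)
  fix n
  have "(cmod (x n + y n))\<^sup>2 \<le> (cmod (x n) + cmod (y n))\<^sup>2"
    by (intro power_mono norm_triangle_ineq norm_ge_zero)
  also have "\<dots> \<le> 2 * (cmod (x n))\<^sup>2 + 2 * (cmod (y n))\<^sup>2"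
    using sum_squares_bound[of "cmod (x n)" "cmod (y n)"] by (simp add: power2_sum)
  finally show "norm ((cmod (x n + y n))\<^sup>2) \<le> 2 * (cmod (x n))\<^sup>2 + 2 * (cmod (y n))\<^sup>2"
    by simp
qed

lemma summable_sq_mult:
  fixes x :: "nat \<Rightarrow> complex"
  assumes "summable (\<lambda>n. (cmod (x n))\<^sup>2)"
  shows "summable (\<lambda>n. (cmod (c * x n))\<^sup>2)"
  using summable_mult[OF assms, of "(cmod c)\<^sup>2"] by (simp add: norm_mult power_mult_distrib)

lemma summable_ell2_inner: "summable (\<lambda>n. ell2_nth x n \<bullet> ell2_nth y n)"
proof (rule summable_comparison_test'[where N = 0])
  show "summable (\<lambda>n. (cmod (ell2_nth x n))\<^sup>2 + (cmod (ell2_nth y n))\<^sup>2)"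
    by (intro summable_add summable_ell2)
  fix n
  have "\<bar>ell2_nth x n \<bullet> ell2_nth y n\<bar> \<le> cmod (ell2_nth x n) * cmod (ell2_nth y n)"
    by (rule Cauchy_Schwarz_ineq2)
  also have "\<dots> \<le> 2 * cmod (ell2_nth x n) * cmod (ell2_nth y n)"
    by simp
  also have "\<dots> \<le> (cmod (ell2_nth x n))\<^sup>2 + (cmod (ell2_nth y n))\<^sup>2"
    by (rule sum_squares_bound)
  finally show "norm (ell2_nth x n \<bullet> ell2_nth y n)
      \<le> (cmod (ell2_nth x n))\<^sup>2 + (cmod (ell2_nth y n))\<^sup>2"
    by simp
qed

lift_definition scaleC_ell2 :: "complex \<Rightarrow> ell2 \<Rightarrow> ell2"
  is "\<lambda>c x n. c * x n"
  by (rule summable_sq_mult)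

text \<open>
  The real inner product is the real part of the Hermitian one; it induces the same norm
  \<open>sqrt (\<Sum>n. (cmod (x n))\<^sup>2)\<close>.
\<close>

instantiation ell2 :: real_inner
begin

lift_definition zero_ell2 :: ell2 is "\<lambda>_. 0"
  by simp

lift_definition plus_ell2 :: "ell2 \<Rightarrow> ell2 \<Rightarrow> ell2" is "\<lambda>x y n. x n + y n"
  by (rule summable_sq_add)

lift_definition uminus_ell2 :: "ell2 \<Rightarrow> ell2" is "\<lambda>x n. - x n"
  by simp

definition minus_ell2 :: "ell2 \<Rightarrow> ell2 \<Rightarrow> ell2"
  where "x - y = x + (- y)" for x y :: ell2

definition scaleR_ell2 :: "real \<Rightarrow> ell2 \<Rightarrow> ell2"
  where "r *\<^sub>R x = scaleC_ell2 (complex_of_real r) x" for x :: ell2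

definition inner_ell2 :: "ell2 \<Rightarrow> ell2 \<Rightarrow> real"
  where "x \<bullet> y = (\<Sum>n. ell2_nth x n \<bullet> ell2_nth y n)" for x y :: ell2

definition norm_ell2 :: "ell2 \<Rightarrow> real"
  where "norm x = sqrt (\<Sum>n. (cmod (ell2_nth x n))\<^sup>2)" for x :: ell2

definition sgn_ell2 :: "ell2 \<Rightarrow> ell2"
  where "sgn x = inverse (norm x) *\<^sub>R x" for x :: ell2

definition dist_ell2 :: "ell2 \<Rightarrow> ell2 \<Rightarrow> real"
  where "dist x y = norm (x - y)" for x y :: ell2

definition uniformity_ell2 :: "(ell2 \<times> ell2) filter"
  where "uniformity_ell2 = (INF e\<in>{0<..}. principal {(x, y). dist x y < e})"

definition open_ell2 :: "ell2 set \<Rightarrow> bool"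
  where "open_ell2 U = (\<forall>x\<in>U. \<forall>\<^sub>F (x', y) in uniformity. x' = x \<longrightarrow> y \<in> U)"

instance
proof
  fix x y z :: ell2 and a b r :: real and U :: "ell2 set"
  show "x + y + z = x + (y + z)" "x + y = y + x" "0 + x = x" "- x + x = 0"
    by (transfer; simp add: algebra_simps fun_eq_iff)+
  show "x - y = x + - y"
    by (rule minus_ell2_def)
  show "a *\<^sub>R (x + y) = a *\<^sub>R x + a *\<^sub>R y" "(a + b) *\<^sub>R x = a *\<^sub>R x + b *\<^sub>R x"
    "a *\<^sub>R b *\<^sub>R x = (a * b) *\<^sub>R x" "1 *\<^sub>R x = x"
    unfolding scaleR_ell2_def by (transfer; simp add: algebra_simps fun_eq_iff)+
  show "dist x y = norm (x - y)"
    by (rule dist_ell2_def)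
  show "sgn x = inverse (norm x) *\<^sub>R x"
    by (rule sgn_ell2_def)
  show "uniformity = (INF e\<in>{0<..}. principal {(x :: ell2, y). dist x y < e})"
    by (rule uniformity_ell2_def)
  show "open U = (\<forall>x\<in>U. \<forall>\<^sub>F (x', y) in uniformity. x' = x \<longrightarrow> y \<in> U)"
    by (rule open_ell2_def)
  show "x \<bullet> y = y \<bullet> x"
    by (simp add: inner_ell2_def inner_commute)
  show "(x + y) \<bullet> z = x \<bullet> z + y \<bullet> z"
    by (simp add: inner_ell2_def plus_ell2.rep_eq inner_add_left suminf_add summable_ell2_inner)
  show "(r *\<^sub>R x) \<bullet> y = r * (x \<bullet> y)"
    by (simp add: inner_ell2_def scaleR_ell2_def scaleC_ell2.rep_eq
        scaleR_conv_of_real[symmetric] suminf_mult summable_ell2_inner)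
  have eq: "x \<bullet> x = (\<Sum>n. (cmod (ell2_nth x n))\<^sup>2)"
    by (simp add: inner_ell2_def power2_norm_eq_inner)
  show "0 \<le> x \<bullet> x"
    unfolding eq by (intro suminf_nonneg summable_ell2) simp
  have "(x \<bullet> x = 0) = (\<forall>n. ell2_nth x n = 0)"
    unfolding eq by (subst suminf_eq_zero_iff) (simp_all add: summable_ell2)
  then show "(x \<bullet> x = 0) = (x = 0)"
    by (simp add: ell2_nth_inject[symmetric] zero_ell2.rep_eq fun_eq_iff)
  show "norm x = sqrt (x \<bullet> x)"
    unfolding norm_ell2_def eq ..
qed

end

interpretation ell2: vector_space scaleC_ell2
  by unfold_locales (transfer; simp add: algebra_simps fun_eq_iff)+

lemma norm_scaleC_ell2: "norm (scaleC_ell2 c x) = cmod c * norm x"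
  by (simp add: norm_ell2_def scaleC_ell2.rep_eq norm_mult power_mult_distrib
      suminf_mult summable_ell2 real_sqrt_mult)

lemma bounded_linear_scaleC_ell2: "bounded_linear (scaleC_ell2 c)"
proof (rule bounded_linear_intro[where K = "cmod c"])
  fix x y :: ell2 and r :: real
  show "scaleC_ell2 c (x + y) = scaleC_ell2 c x + scaleC_ell2 c y"
    by (rule ell2.scale_right_distrib)
  show "scaleC_ell2 c (r *\<^sub>R x) = r *\<^sub>R scaleC_ell2 c x"
    by (simp add: scaleR_ell2_def mult.commute)
  show "norm (scaleC_ell2 c x) \<le> norm x * cmod c"
    by (simp add: norm_scaleC_ell2 mult.commute)
qed

text \<open>
  The type \<open>ell2 \<Rightarrow>\<^sub>L ell2\<close> consists of the bounded \<^emph>\<open>real\<close>-linear operators; \<open>bounded_ops\<close>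
  singles out the complex-linear ones. On them the norm of the type is the operator norm.
\<close>

definition scaleC_op :: "complex \<Rightarrow> (ell2 \<Rightarrow>\<^sub>L ell2) \<Rightarrow> (ell2 \<Rightarrow>\<^sub>L ell2)"
  where "scaleC_op c A = Blinfun (\<lambda>x. scaleC_ell2 c (blinfun_apply A x))"

lemma scaleC_op_apply [simp]:
  "blinfun_apply (scaleC_op c A) x = scaleC_ell2 c (blinfun_apply A x)"
  unfolding scaleC_op_def
  by (simp add: bounded_linear_Blinfun_apply
      bounded_linear_compose[OF bounded_linear_scaleC_ell2 blinfun.bounded_linear_right])

interpretation op: vector_space scaleC_op
  by unfold_locales
    (rule blinfun_eqI;
     simp add: blinfun.add_left ell2.scale_right_distrib ell2.scale_left_distrib)+

definition bounded_ops :: "(ell2 \<Rightarrow>\<^sub>L ell2) set"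
  where "bounded_ops = {A. Vector_Spaces.linear scaleC_ell2 scaleC_ell2 (blinfun_apply A)}"

definition compact_ops :: "(ell2 \<Rightarrow>\<^sub>L ell2) set"
  where "compact_ops = {A \<in> bounded_ops. compact (closure (blinfun_apply A ` cball 0 1))}"

text \<open>
  The norm of the type \<open>complex ^ 'm\<close> is the Euclidean one, so the norm of the complex
  \<open>m\<close>-dimensional \<open>\<ell>\<^sub>1\<close> is a separate function.
\<close>

definition l1_norm :: "complex ^ 'm \<Rightarrow> real"
  where "l1_norm z = (\<Sum>i\<in>UNIV. cmod (z $ i))"

end

theory Submission
  imports Defs
begin

text \<open>
  Two coordinate vectors of \<open>\<ell>\<^sub>1\<^sup>m\<close> are sent to contractions \<open>A\<close>, \<open>B\<close> with \<open>\<parallel>A + \<lambda>B\<parallel> = 2\<close> for every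
  \<open>\<lambda>\<close> on the unit circle. If \<open>\<parallel>(A + \<lambda>B)x\<parallel> \<approx> 2\<close> with \<open>\<parallel>x\<parallel> \<le> 1\<close>, then \<open>Ax \<approx> \<lambda>Bx\<close> and
  \<open>\<parallel>Ax\<parallel> \<approx> \<parallel>Bx\<parallel> \<approx> 1\<close>. Contractions almost preserve inner products with vectors on which they are
  almost isometric, so for such vectors \<open>x\<close>, \<open>y\<close> belonging to \<open>\<lambda> \<noteq> \<mu>\<close> the Hermitian product satisfies
  \<open>\<langle>x, y\<rangle> \<approx> \<langle>Ax, Ay\<rangle> \<approx> \<langle>\<lambda>Bx, \<mu>By\<rangle> \<approx> \<lambda> cnj \<mu> \<langle>x, y\<rangle>\<close>, whence \<open>Ax\<close> and \<open>Ay\<close> are almost orthogonal.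
  Limit points of the \<open>Ax\<close> thus form an infinite orthonormal family in the compact closure of the
  image of the unit ball under \<open>A\<close>, which is impossible. Working with approximate maximisers makes
  completeness of \<open>\<ell>\<^sub>2\<close> unnecessary.
\<close>

section \<open>Contractions and the real inner product\<close>

lemma inner_scaleC_ell2:
  "scaleC_ell2 c x \<bullet> scaleC_ell2 c y = (cmod c)\<^sup>2 * (x \<bullet> y)"
proof -
  have "(c * a) \<bullet> (c * b) = (cmod c)\<^sup>2 * (a \<bullet> b)" for a b
    unfolding cmod_power2 by (simp add: inner_complex_def power2_eq_square algebra_simps)
  then show ?thesis
    by (simp add: inner_ell2_def scaleC_ell2.rep_eq suminf_mult summable_ell2_inner)
qed

text \<open>This is Cauchy-Schwarz for the positive semidefinite form
  \<open>q x y = x \<bullet> y - A x \<bullet> A y\<close>, with the factor \<open>q x x\<close>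
  bounded by 1.\<close>

lemma contraction_inner_defect:
  fixes A :: "'a::real_inner \<Rightarrow>\<^sub>L 'a"
  assumes "norm A \<le> 1" "norm x \<le> 1"
  shows "\<bar>A x \<bullet> A y - x \<bullet> y\<bar> \<le> sqrt ((norm y)\<^sup>2 - (norm (A y))\<^sup>2)"
proof -
  \<comment> \<open>With \<open>b = q x y\<close>, nonnegativity of \<open>q\<close> at
    \<open>y - b *\<^sub>R x\<close> gives \<open>2 b^2 \<le> q y y + b^2 q x x\<close>.\<close>
  define b where "b = x \<bullet> y - A x \<bullet> A y"
  have contr: "norm (A z) \<le> norm z" for z
    using norm_blinfun[of A z] mult_right_mono[OF assms(1), of "norm z"] by simp
  have "(norm (A (y - b *\<^sub>R x)))\<^sup>2 \<le> (norm (y - b *\<^sub>R x))\<^sup>2"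
    by (intro power_mono contr norm_ge_zero)
  then have "2 * b * (x \<bullet> y - A x \<bullet> A y)
      \<le> ((norm y)\<^sup>2 - (norm (A y))\<^sup>2) + b * b * ((norm x)\<^sup>2 - (norm (A x))\<^sup>2)"
    by (simp add: power2_norm_eq_inner blinfun.diff_right blinfun.scaleR_right inner_diff_left
        inner_diff_right inner_commute[of y x] inner_commute[of "A y" "A x"] right_diff_distrib
        mult.assoc)
  then have "2 * b * b \<le> ((norm y)\<^sup>2 - (norm (A y))\<^sup>2) + b * b * ((norm x)\<^sup>2 - (norm (A x))\<^sup>2)"
    unfolding b_def[symmetric] .
  also have "b * b * ((norm x)\<^sup>2 - (norm (A x))\<^sup>2) \<le> b * b * 1"
  proof (intro mult_left_mono)
    have "(norm x)\<^sup>2 \<le> 1"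
      using assms(2) by (simp add: power_le_one)
    then show "(norm x)\<^sup>2 - (norm (A x))\<^sup>2 \<le> 1"
      using zero_le_power2[of "norm (A x)"] by linarith
  qed simp
  finally have "b\<^sup>2 \<le> (norm y)\<^sup>2 - (norm (A y))\<^sup>2"
    by (simp add: power2_eq_square)
  then have "\<bar>b\<bar> \<le> sqrt ((norm y)\<^sup>2 - (norm (A y))\<^sup>2)"
    using real_sqrt_le_mono by fastforce
  then show ?thesis
    by (simp add: b_def abs_minus_commute)
qed

text \<open>The bound involves only \<open>Y\<close>, so \<open>X\<close> may be any sequence in the
  unit ball, in particular a rotated or rescaled one.\<close>

lemma contraction_inner_defect_tendsto:
  fixes A :: "'a::real_inner \<Rightarrow>\<^sub>L 'a"
  assumes "norm A \<le> 1" "\<And>n. norm (X n) \<le> 1" "\<And>n. norm (Y n) \<le> 1"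
    and "(\<lambda>n. norm (A (Y n))) \<longlonglongrightarrow> 1"
  shows "(\<lambda>n. A (X n) \<bullet> A (Y n) - X n \<bullet> Y n) \<longlonglongrightarrow> 0"
proof (rule Lim_null_comparison)
  have "\<bar>A (X n) \<bullet> A (Y n) - X n \<bullet> Y n\<bar> \<le> sqrt (1 - (norm (A (Y n)))\<^sup>2)" for n
  proof -
    have "(norm (Y n))\<^sup>2 \<le> 1"
      using assms(3) by (simp add: power_le_one)
    then show ?thesis
      using contraction_inner_defect[OF assms(1,2), of n "Y n"]
      by (smt (verit) real_sqrt_le_mono)
  qed
  then show "\<forall>\<^sub>F n in sequentially.
      norm (A (X n) \<bullet> A (Y n) - X n \<bullet> Y n) \<le> sqrt (1 - (norm (A (Y n)))\<^sup>2)"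
    by simp
  have "(\<lambda>n. sqrt (1 - (norm (A (Y n)))\<^sup>2)) \<longlonglongrightarrow> sqrt (1 - 1\<^sup>2)"
    by (intro tendsto_intros assms(4))
  then show "(\<lambda>n. sqrt (1 - (norm (A (Y n)))\<^sup>2)) \<longlonglongrightarrow> 0"
    by simp
qed

section \<open>Asymptotic orthogonality for distinct phases\<close>

lemma bounded_ops_scaleC:
  assumes "A \<in> bounded_ops"
  shows "blinfun_apply A (scaleC_ell2 c x) = scaleC_ell2 c (blinfun_apply A x)"
proof -
  interpret Vector_Spaces.linear scaleC_ell2 scaleC_ell2 "blinfun_apply A"
    using assms by (simp add: bounded_ops_def)
  show ?thesis
    by (rule scale)
qed

text \<open>Passing from \<open>A\<close> to \<open>B\<close> through the eigenrelations costs the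
  phase \<open>l / m\<close>, while both contractions nearly preserve products with
  \<open>Y n\<close>. So these products barely change when the first factor is rotated by
  \<open>l / m \<noteq> 1\<close>, which forces them to 0.\<close>

lemma eigensequences_asymptotically_orthogonal:
  fixes A B :: "ell2 \<Rightarrow>\<^sub>L ell2"
  assumes A: "A \<in> bounded_ops" "norm A \<le> 1" and B: "B \<in> bounded_ops" "norm B \<le> 1"
    and unit: "cmod l = 1" "cmod m = 1" and "l \<noteq> m"
    and X: "\<And>n. norm (X n) \<le> 1" and Y: "\<And>n. norm (Y n) \<le> 1"
    and AY: "(\<lambda>n. norm (A (Y n))) \<longlonglongrightarrow> 1" and BY: "(\<lambda>n. norm (B (Y n))) \<longlonglongrightarrow> 1"
    and eX: "(\<lambda>n. A (X n) - scaleC_ell2 l (B (X n))) \<longlonglongrightarrow> 0"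
    and eY: "(\<lambda>n. A (Y n) - scaleC_ell2 m (B (Y n))) \<longlonglongrightarrow> 0"
  shows "(\<lambda>n. A (X n) \<bullet> A (Y n)) \<longlonglongrightarrow> 0"
proof -
  define v where "v = l / m"
  define d where "d = 1 - v"
  \<comment> \<open>only real inner products are available; the factor \<open>c\<close> turns \<open>1 - v\<close> into a positive real\<close>
  define c where "c = cnj d / 2"
  define U where "U n = scaleC_ell2 c (X n)" for n
  have "m \<noteq> 0"
    using unit by auto
  have v: "cmod v = 1" "l = m * v"
    using unit \<open>m \<noteq> 0\<close> by (auto simp: v_def norm_divide)
  have "d \<noteq> 0"
    using \<open>l \<noteq> m\<close> \<open>m \<noteq> 0\<close> by (simp add: d_def v_def)
  have "cmod d \<le> 2"
    using norm_triangle_ineq4[of 1 v] v by (simp add: d_def)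
  \<comment> \<open>This bound keeps \<open>U n\<close> in the unit ball, as the defect lemma
    requires.\<close>
  then have c: "cmod c \<le> 1"
    by (simp add: c_def norm_divide)
  have U: "norm (U n) \<le> 1" for n
    unfolding U_def norm_scaleC_ell2 using c X[of n] by (simp add: mult_le_one)
  have vU: "norm (scaleC_ell2 v (U n)) \<le> 1" for n
    using U[of n] v by (simp add: norm_scaleC_ell2)
  have contr: "norm (C x) \<le> 1" if "norm C \<le> 1" "norm x \<le> 1" for C :: "ell2 \<Rightarrow>\<^sub>L ell2" and x
    using norm_blinfun[of C x] mult_le_one[OF that(1) norm_ge_zero that(2)] by simp
  have eU: "(\<lambda>n. A (U n) - scaleC_ell2 l (B (U n))) \<longlonglongrightarrow> 0"
  proof -
    have "A (U n) - scaleC_ell2 l (B (U n)) = scaleC_ell2 c (A (X n) - scaleC_ell2 l (B (X n)))" for n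
      by (simp add: U_def bounded_ops_scaleC A B ell2.scale_right_diff_distrib mult.commute)
    then show ?thesis
      using bounded_linear.tendsto_zero[OF bounded_linear_scaleC_ell2 eX] by simp
  qed
  have bilin: "(\<lambda>n. x n \<bullet> y n) \<longlonglongrightarrow> 0" if "x \<longlonglongrightarrow> 0" "\<And>n. norm (y n) \<le> 1" for x y :: "nat \<Rightarrow> ell2"
  proof (rule Lim_null_comparison)
    have "\<bar>x n \<bullet> y n\<bar> \<le> norm (x n)" for n
      using Cauchy_Schwarz_ineq2[of "x n" "y n"] mult_left_mono[OF that(2), of "norm (x n)" n] by simp
    then show "\<forall>\<^sub>F n in sequentially. norm (x n \<bullet> y n) \<le> norm (x n)"
      by simp
    show "(\<lambda>n. norm (x n)) \<longlonglongrightarrow> 0"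
      using that(1) by (rule tendsto_norm_zero)
  qed
  have 1: "(\<lambda>n. A (U n) \<bullet> A (Y n) - U n \<bullet> Y n) \<longlonglongrightarrow> 0"
    by (rule contraction_inner_defect_tendsto[OF A(2) U Y AY])
  have 2: "(\<lambda>n. B (scaleC_ell2 v (U n)) \<bullet> B (Y n) - scaleC_ell2 v (U n) \<bullet> Y n) \<longlonglongrightarrow> 0"
    by (rule contraction_inner_defect_tendsto[OF B(2) vU Y BY])
  have 3: "(\<lambda>n. (A (U n) - scaleC_ell2 l (B (U n))) \<bullet> A (Y n)) \<longlonglongrightarrow> 0"
    by (rule bilin[OF eU contr[OF A(2) Y]])
  have 4: "(\<lambda>n. (A (Y n) - scaleC_ell2 m (B (Y n))) \<bullet> scaleC_ell2 l (B (U n))) \<longlonglongrightarrow> 0"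
    by (rule bilin[OF eY]) (simp add: norm_scaleC_ell2 unit contr[OF B(2) U])
  \<comment> \<open>Rotating both factors by the unimodular \<open>m\<close> preserves the real
    product, and \<open>l = m * v\<close>.\<close>
  have rot: "scaleC_ell2 l (B (U n)) \<bullet> scaleC_ell2 m (B (Y n)) = B (scaleC_ell2 v (U n)) \<bullet> B (Y n)" for n
    using inner_scaleC_ell2[of m "scaleC_ell2 v (B (U n))" "B (Y n)"] v unit
    by (simp add: bounded_ops_scaleC B)
  have UY: "U n \<bullet> Y n - scaleC_ell2 v (U n) \<bullet> Y n = (cmod d)\<^sup>2 / 2 * (X n \<bullet> Y n)" for n
  proof -
    have "U n - scaleC_ell2 v (U n) = scaleC_ell2 (d * c) (X n)"
      by (simp add: U_def d_def ell2.scale_left_diff_distrib algebra_simps)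
    also have "d * c = complex_of_real ((cmod d)\<^sup>2 / 2)"
      by (simp add: c_def complex_norm_square del: of_real_power)
    finally show ?thesis
      by (metis inner_diff_left inner_scaleR_left scaleR_ell2_def)
  qed
  \<comment> \<open>By \<open>UY\<close> the left side is the change of the product under rotation
    by \<open>v\<close>; it telescopes into the four null sequences above.\<close>
  have "(cmod d)\<^sup>2 / 2 * (X n \<bullet> Y n)
      = (A (U n) - scaleC_ell2 l (B (U n))) \<bullet> A (Y n)
        + (A (Y n) - scaleC_ell2 m (B (Y n))) \<bullet> scaleC_ell2 l (B (U n))
        + (B (scaleC_ell2 v (U n)) \<bullet> B (Y n) - scaleC_ell2 v (U n) \<bullet> Y n)
        - (A (U n) \<bullet> A (Y n) - U n \<bullet> Y n)" for n
    unfolding UY[symmetric] rot[symmetric]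
    by (simp add: inner_diff_left inner_commute[of "scaleC_ell2 l (B (U n))"])
  then have "(\<lambda>n. (cmod d)\<^sup>2 / 2 * (X n \<bullet> Y n)) \<longlonglongrightarrow> 0"
    using tendsto_diff[OF tendsto_add[OF tendsto_add[OF 3 4] 2] 1] by (simp only: add_0 diff_0_right)
  then have "(\<lambda>n. X n \<bullet> Y n) \<longlonglongrightarrow> 0"
    using tendsto_mult_left_iff[of "(cmod d)\<^sup>2 / 2" "\<lambda>n. X n \<bullet> Y n" 0 sequentially] \<open>d \<noteq> 0\<close>
    by simp
  then show ?thesis
    using tendsto_add[OF contraction_inner_defect_tendsto[of A X Y, OF A(2) X Y AY]] by fastforce
qed

section \<open>Approximate maximisers\<close>

lemma blinfun_approx_norm:
  fixes C :: "'a::real_normed_vector \<Rightarrow>\<^sub>L 'b::real_normed_vector"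
  assumes "r < norm C" "0 \<le> r"
  obtains x where "norm x \<le> 1" "r < norm (C x)"
proof -
  have "\<exists>x. r * norm x < norm (C x)"
    using norm_blinfun_bound[OF assms(2), of C] assms(1) by (meson not_le)
  then obtain x where x: "r * norm x < norm (C x)" ..
  then have "x \<noteq> 0"
    by auto
  show thesis
  proof
    show "norm (x /\<^sub>R norm x) \<le> 1"
      using \<open>x \<noteq> 0\<close> by simp
    show "r < norm (C (x /\<^sub>R norm x))"
      using x \<open>x \<noteq> 0\<close> by (simp add: blinfun.scaleR_right field_simps)
  qed
qed

text \<open>If two vectors of norm at most 1 have a sum of norm near 2, both norms are near 1, and
  by the parallelogram law their difference is small.\<close>

lemma norming_eigensequence:
  fixes A B :: "ell2 \<Rightarrow>\<^sub>L ell2"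
  assumes A: "norm A \<le> 1" and B: "norm B \<le> 1" and "cmod l = 1"
    and AB: "norm (A + scaleC_op l B) = 2"
  obtains X where "\<And>n. norm (X n) \<le> 1"
    "(\<lambda>n. norm (A (X n))) \<longlonglongrightarrow> 1" "(\<lambda>n. norm (B (X n))) \<longlonglongrightarrow> 1"
    "(\<lambda>n. A (X n) - scaleC_ell2 l (B (X n))) \<longlonglongrightarrow> 0"
proof -
  \<comment> \<open>Since \<open>0 < e n \<le> 1\<close>, the threshold \<open>2 - e n\<close> is
    below the norm 2 and nonnegative, so it can be squared.\<close>
  define e :: "nat \<Rightarrow> real" where "e n = inverse (real (Suc n))" for n
  have e: "0 < e n" "e n \<le> 1" for n
    by (auto simp: e_def field_simps)
  have e0: "e \<longlonglongrightarrow> 0"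
    unfolding e_def by (rule LIMSEQ_inverse_real_of_nat)
  have "\<exists>x. norm x \<le> 1 \<and> 2 - e n < norm ((A + scaleC_op l B) x)" for n
    by (rule blinfun_approx_norm[of "2 - e n" "A + scaleC_op l B"]) (use e[of n] AB in auto)
  then obtain X where X: "\<And>n. norm (X n) \<le> 1"
    and "\<And>n. 2 - e n < norm ((A + scaleC_op l B) (X n))"
    by metis
  then have sum: "2 - e n < norm (A (X n) + scaleC_ell2 l (B (X n)))" for n
    by (simp add: blinfun.add_left)
  have lB: "norm (scaleC_ell2 l (B (X n))) = norm (B (X n))" for n
    by (simp add: norm_scaleC_ell2 assms)
  have contr: "norm (C (X n)) \<le> 1" if "norm C \<le> 1" for C :: "ell2 \<Rightarrow>\<^sub>L ell2" and n
    using norm_blinfun[of C "X n"] mult_le_one[OF that norm_ge_zero X] by (rule order_trans)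
  have ge: "1 - e n \<le> norm (A (X n))" "1 - e n \<le> norm (B (X n))" for n
    using sum[of n] norm_triangle_ineq[of "A (X n)" "scaleC_ell2 l (B (X n))"]
      contr[OF A, of n] contr[OF B, of n] lB[of n] by linarith+
  have lim1: "(\<lambda>n. 1 - e n) \<longlonglongrightarrow> 1"
    using tendsto_diff[OF tendsto_const e0, of 1] by simp
  have diff: "norm (A (X n) - scaleC_ell2 l (B (X n))) \<le> sqrt (4 - (2 - e n)\<^sup>2)" for n
  proof (rule real_le_rsqrt)
    have "(norm (A (X n) - scaleC_ell2 l (B (X n))))\<^sup>2
        = 2 * (norm (A (X n)))\<^sup>2 + 2 * (norm (B (X n)))\<^sup>2
          - (norm (A (X n) + scaleC_ell2 l (B (X n))))\<^sup>2"
      unfolding lB[symmetric]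
      by (simp add: power2_norm_eq_inner inner_diff_left inner_diff_right inner_add_left
          inner_add_right inner_commute)
    also have "\<dots> \<le> 2 * 1 + 2 * 1 - (2 - e n)\<^sup>2"
      using contr[OF A, of n] contr[OF B, of n] sum[of n] e[of n]
      by (intro diff_mono add_mono mult_left_mono power_le_one power_mono) auto
    finally show "(norm (A (X n) - scaleC_ell2 l (B (X n))))\<^sup>2 \<le> 4 - (2 - e n)\<^sup>2"
      by simp
  qed
  have "(\<lambda>n. sqrt (4 - (2 - e n)\<^sup>2)) \<longlonglongrightarrow> sqrt (4 - (2 - 0)\<^sup>2)"
    by (intro tendsto_intros e0)
  then have lim0: "(\<lambda>n. sqrt (4 - (2 - e n)\<^sup>2)) \<longlonglongrightarrow> 0"
    by simp
  show thesis
  proof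
    show "norm (X n) \<le> 1" for n
      by (rule X)
    show "(\<lambda>n. norm (A (X n))) \<longlonglongrightarrow> 1"
      by (rule tendsto_sandwich[OF _ _ lim1 tendsto_const]) (auto simp: ge contr A)
    show "(\<lambda>n. norm (B (X n))) \<longlonglongrightarrow> 1"
      by (rule tendsto_sandwich[OF _ _ lim1 tendsto_const]) (auto simp: ge contr B)
    show "(\<lambda>n. A (X n) - scaleC_ell2 l (B (X n))) \<longlonglongrightarrow> 0"
      by (rule Lim_null_comparison[OF _ lim0]) (simp add: diff)
  qed
qed

section \<open>Compactness against infinitely many phases\<close>

lemma compact_no_infinite_orthonormal:
  fixes y :: "nat \<Rightarrow> 'a::real_inner"
  assumes "compact K" "\<And>n. y n \<in> K" "\<And>n. norm (y n) = 1"
    and orth: "\<And>i j. i \<noteq> j \<Longrightarrow> y i \<bullet> y j = 0"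
  shows False
proof -
  obtain z r where r: "strict_mono (r :: nat \<Rightarrow> nat)" and "(y \<circ> r) \<longlonglongrightarrow> z"
    using assms(1,2) by (meson compact_imp_seq_compact seq_compactE)
  then have "Cauchy (y \<circ> r)"
    by (intro LIMSEQ_imp_Cauchy)
  then obtain N where "dist (y (r N)) (y (r (Suc N))) < 1"
    by (metis Cauchy_def comp_apply le_SucI order_refl zero_less_one)
  then have "(norm (y (r N) - y (r (Suc N))))\<^sup>2 < 1"
    by (simp add: dist_norm power_less_one_iff)
  \<comment> \<open>Distinct indices give orthogonal unit vectors, at squared distance 2.\<close>
  moreover have "r N \<noteq> r (Suc N)"
    using r by (simp add: strict_mono_eq)
  then have "(norm (y (r N) - y (r (Suc N))))\<^sup>2 = (norm (y (r N)))\<^sup>2 + (norm (y (r (Suc N))))\<^sup>2"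
    using orth by (simp add: power2_norm_eq_inner inner_diff_left inner_diff_right inner_commute)
  ultimately show False
    using assms(3) by simp
qed

text \<open>Compactness of \<open>A\<close> makes the approximate relations exact: for each phase
  the images of a norming sequence accumulate at a unit vector, and distinct phases give orthogonal
  limits.\<close>

lemma compact_ops_not_l1_pair:
  assumes A: "A \<in> compact_ops" "norm A \<le> 1" and B: "B \<in> bounded_ops" "norm B \<le> 1"
  shows "\<exists>l. cmod l = 1 \<and> norm (A + scaleC_op l B) \<noteq> 2"
proof (rule ccontr)
  assume "\<not> ?thesis"
  then have two: "norm (A + scaleC_op l B) = 2" if "cmod l = 1" for l
    using that by blast
  define K where "K = closure (blinfun_apply A ` cball 0 1)"
  have "compact K" and A': "A \<in> bounded_ops"
    using A by (auto simp: K_def compact_ops_def)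
  \<comment> \<open>A finite connected set has at most one point, but the circle contains 1 and
    -1.\<close>
  have "infinite (sphere (0::complex) 1)"
  proof
    assume "finite (sphere (0::complex) 1)"
    then obtain a where "sphere (0::complex) 1 \<subseteq> {a}"
      using connected_finite_iff_sing[OF connected_sphere[of "0::complex" 1]] by auto
    moreover have "1 \<in> sphere (0::complex) 1" "- 1 \<in> sphere (0::complex) 1"
      by simp_all
    ultimately show False
      by (metis one_neq_neg_one singletonD subsetD)
  qed
  then obtain l :: "nat \<Rightarrow> complex" where "inj l" and l: "range l \<subseteq> sphere 0 1"
    using infinite_countable_subset by blast
  then have l1: "cmod (l k) = 1" for k
    by (auto simp: image_subset_iff)
  \<comment> \<open>Bundling a norming sequence with the limit of its images lets both be chosen for
    all \<open>k\<close> at once.\<close>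
  define good where "good k X y \<longleftrightarrow> (\<forall>n. norm (X n) \<le> 1)
      \<and> (\<lambda>n. norm (A (X n))) \<longlonglongrightarrow> 1 \<and> (\<lambda>n. norm (B (X n))) \<longlonglongrightarrow> 1
      \<and> (\<lambda>n. A (X n) - scaleC_ell2 (l k) (B (X n))) \<longlonglongrightarrow> 0
      \<and> y \<in> K \<and> (\<lambda>n. A (X n)) \<longlonglongrightarrow> y" for k X y
  have "\<exists>X y. good k X y" for k
  proof -
    obtain X where X: "\<And>n. norm (X n) \<le> 1"
      "(\<lambda>n. norm (A (X n))) \<longlonglongrightarrow> 1" "(\<lambda>n. norm (B (X n))) \<longlonglongrightarrow> 1"
      "(\<lambda>n. A (X n) - scaleC_ell2 (l k) (B (X n))) \<longlonglongrightarrow> 0"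
      using norming_eigensequence[OF A(2) B(2) l1 two[OF l1]] by blast
    have "\<forall>n. A (X n) \<in> K"
      using X(1) closure_subset by (fastforce simp: K_def)
    then obtain y r where "y \<in> K" "strict_mono (r :: nat \<Rightarrow> nat)" "((\<lambda>n. A (X n)) \<circ> r) \<longlonglongrightarrow> y"
      using \<open>compact K\<close> by (meson compact_imp_seq_compact seq_compactE)
    then have "good k (X \<circ> r) y"
      using X(1) X(2-4)[THEN LIMSEQ_subseq_LIMSEQ] by (simp add: good_def o_def)
    then show ?thesis
      by blast
  qed
  then obtain X y where g: "\<And>k. good k (X k) (y k)"
    by metis
  show False
  proof (rule compact_no_infinite_orthonormal[OF \<open>compact K\<close>])
    show "y k \<in> K" for k
      using g[of k] by (simp add: good_def)
    show "norm (y k) = 1" for k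
      using g[of k] tendsto_norm LIMSEQ_unique unfolding good_def by blast
    fix i j :: nat
    assume "i \<noteq> j"
    then have "l i \<noteq> l j"
      using \<open>inj l\<close> by (simp add: inj_eq)
    \<comment> \<open>Each phase keeps its own subsequence: any two norming sequences may be paired
      index by index, without a diagonal extraction.\<close>
    then have "(\<lambda>n. A (X i n) \<bullet> A (X j n)) \<longlonglongrightarrow> 0"
      using g[of i] g[of j] unfolding good_def
      by (intro eigensequences_asymptotically_orthogonal[OF A' A(2) B l1 l1]) auto
    moreover have "(\<lambda>n. A (X i n) \<bullet> A (X j n)) \<longlonglongrightarrow> y i \<bullet> y j"
      using g[of i] g[of j] unfolding good_def by (intro tendsto_inner) auto
    ultimately show "y i \<bullet> y j = 0"
      using LIMSEQ_unique by blast
  qed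
qed

section \<open>Two coordinate vectors of the complex l1 space\<close>

lemma l1_norm_axis_add:
  assumes "i \<noteq> j"
  shows "l1_norm (axis i a + axis j b) = cmod a + cmod b"
proof -
  have "l1_norm (axis i a + axis j b)
      = (\<Sum>k\<in>UNIV. (if k = i then cmod a else 0) + (if k = j then cmod b else 0))"
    unfolding l1_norm_def using assms by (intro sum.cong) (auto simp: axis_def)
  then show ?thesis
    by (simp add: sum.distrib)
qed

theorem theorem1p1:
  assumes "CARD('m::finite) \<ge> 2"
  shows "\<not> (\<exists>T :: complex ^ 'm \<Rightarrow> (ell2 \<Rightarrow>\<^sub>L ell2).
            Vector_Spaces.linear (*s) scaleC_op T \<and>
            range T \<subseteq> compact_ops \<and>
            (\<forall>z. norm (T z) = l1_norm z))"
proof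
  assume "\<exists>T :: complex ^ 'm \<Rightarrow> (ell2 \<Rightarrow>\<^sub>L ell2).
            Vector_Spaces.linear (*s) scaleC_op T \<and>
            range T \<subseteq> compact_ops \<and>
            (\<forall>z. norm (T z) = l1_norm z)"
  then obtain T :: "complex ^ 'm \<Rightarrow> (ell2 \<Rightarrow>\<^sub>L ell2)"
    where lin: "Vector_Spaces.linear (*s) scaleC_op T"
      and range: "range T \<subseteq> compact_ops" and norm: "\<And>z. norm (T z) = l1_norm z"
    by blast
  interpret T: Vector_Spaces.linear "(*s)" scaleC_op T
    by (rule lin)
  obtain i j :: 'm where "i \<noteq> j"
    using assms card_le_Suc0_iff_eq[of "UNIV :: 'm set"] by auto
  define A where "A = T (axis i 1)"
  define B where "B = T (axis j 1)"
  have "A + scaleC_op l B = T (axis i 1 + axis j l)" for l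
  proof -
    have "axis j l = l *s axis j 1"
      by (simp add: vec_eq_iff axis_def)
    then show ?thesis
      by (simp add: A_def B_def T.add T.scale)
  qed
  then have sum: "norm (A + scaleC_op l B) = 1 + cmod l" for l
    by (simp add: norm l1_norm_axis_add[OF \<open>i \<noteq> j\<close>])
  have axis0: "axis k (0 :: complex) = 0" for k :: 'm
    by simp
  \<comment> \<open>A zero coefficient in the two-term formula isolates each coordinate
    vector.\<close>
  have contr: "norm A \<le> 1" "norm B \<le> 1"
    using l1_norm_axis_add[OF \<open>i \<noteq> j\<close>, of 1 0] l1_norm_axis_add[OF \<open>i \<noteq> j\<close>, of 0 1]
    by (simp_all add: A_def B_def norm axis0)
  have "A \<in> compact_ops" "B \<in> bounded_ops"
    using range by (auto simp: A_def B_def compact_ops_def)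
  then obtain l where "cmod l = 1" "norm (A + scaleC_op l B) \<noteq> 2"
    using compact_ops_not_l1_pair[OF _ contr(1) _ contr(2)] by blast
  with sum show False
    by simp
qed

end
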